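(* Let $\Gamma$ be a graph with girth $g \geq 4$. Then $\Gamma$ admits a partial orientation as a quasi-transitive mixed graph if and only if $\Gamma$ has no odd cycle.
   Context: A mixed graph has a vertex set, a set of (undirected) edges and a set of arcs, with at most one edge or arc between any pair of vertices. A partial orientation of a graph $\Gamma$ is a mixed graph obtained from $\Gamma$ by orienting some of its edges as arcs. A $2$-dipath is a directed path $uvw$ consisting of arcs $u\to v$, $v\to w$; it is induced if $u$ and $w$ are not joined by an edge or arc. A mixed graph $H$ is quasi-transitive when (1) it has no induced $2$-dipath and (2) for every edge $uv$ of $H$ there is a vertex $w$ such that $uwv$ or $vwu$ is a $2$-dipath. *)

theory Defs
  imports Main "HOL-Library.Extended_Nat"
begin

record 'a ugraph =
  verts :: "'a set"
  edges :: "'a set set"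

record 'a mgraph = "'a ugraph" +
  arcs :: "('a \<times> 'a) set"

definition simple_graph :: "('a, 'b) ugraph_scheme \<Rightarrow> bool" where
  "simple_graph G \<longleftrightarrow> (\<forall>e\<in>edges G. \<exists>u\<in>verts G. \<exists>v\<in>verts G. u \<noteq> v \<and> e = {u, v})"

text \<open>
  A cycle is given by the list of its vertices in cyclic order; its length is the
  number of its vertices (equivalently, of its edges).
\<close>

definition cycle :: "('a, 'b) ugraph_scheme \<Rightarrow> 'a list \<Rightarrow> bool" where
  "cycle G c \<longleftrightarrow> 3 \<le> length c \<and> distinct c \<and> set c \<subseteq> verts G \<and>
     (\<forall>i<length c. {c ! i, c ! (Suc i mod length c)} \<in> edges G)"

text \<open>The infimum of the empty set is \<open>\<infinity>\<close>, so acyclic graphs have infinite girth.\<close>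

definition girth :: "('a, 'b) ugraph_scheme \<Rightarrow> enat" where
  "girth G = (INF c\<in>{c. cycle G c}. enat (length c))"

definition mixed_graph :: "'a mgraph \<Rightarrow> bool" where
  "mixed_graph H \<longleftrightarrow> simple_graph H \<and>
     (\<forall>u v. (u, v) \<in> arcs H \<longrightarrow>
        u \<in> verts H \<and> v \<in> verts H \<and> u \<noteq> v \<and> (v, u) \<notin> arcs H \<and> {u, v} \<notin> edges H)"

text \<open>
  \<open>S\<close> is the set of edges that get oriented; the bijection says that each of them
  is replaced by exactly one of its two orientations.
\<close>

definition partial_orientation :: "'a ugraph \<Rightarrow> 'a mgraph \<Rightarrow> bool" where
  "partial_orientation G H \<longleftrightarrow> mixed_graph H \<and> verts H = verts G \<and>
     (\<exists>S\<subseteq>edges G. edges H = edges G - S \<and> bij_betw (\<lambda>(u, v). {u, v}) (arcs H) S)"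

definition adjacent :: "'a mgraph \<Rightarrow> 'a \<Rightarrow> 'a \<Rightarrow> bool" where
  "adjacent H u v \<longleftrightarrow> {u, v} \<in> edges H \<or> (u, v) \<in> arcs H \<or> (v, u) \<in> arcs H"

definition two_dipath :: "'a mgraph \<Rightarrow> 'a \<Rightarrow> 'a \<Rightarrow> 'a \<Rightarrow> bool" where
  "two_dipath H u v w \<longleftrightarrow> distinct [u, v, w] \<and> (u, v) \<in> arcs H \<and> (v, w) \<in> arcs H"

definition induced_two_dipath :: "'a mgraph \<Rightarrow> 'a \<Rightarrow> 'a \<Rightarrow> 'a \<Rightarrow> bool" where
  "induced_two_dipath H u v w \<longleftrightarrow> two_dipath H u v w \<and> \<not> adjacent H u w"

definition quasi_transitive :: "'a mgraph \<Rightarrow> bool" where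
  "quasi_transitive H \<longleftrightarrow> mixed_graph H \<and>
     (\<nexists>u v w. induced_two_dipath H u v w) \<and>
     (\<forall>u v. {u, v} \<in> edges H \<longrightarrow> (\<exists>w\<in>verts H. two_dipath H u w v \<or> two_dipath H v w u))"

end

theory Submission
  imports Defs
begin

text \<open>
  In a triangle-free graph every 2-dipath of an orientation is induced, so a quasi-transitive
  partial orientation has no 2-dipath at all, and condition (2) then forces every edge to be
  oriented. Each vertex is therefore a source or a sink, which is a proper 2-colouring. Conversely,
  orienting every edge from the first colour class to the second creates no 2-dipath. A proper
  2-colouring exists iff there is no odd cycle, since every odd closed walk contains an odd cycle.
\<close>

definition proper_2_colouring :: "('a, 'b) ugraph_scheme \<Rightarrow> ('a \<Rightarrow> bool) \<Rightarrow> bool" where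
  "proper_2_colouring G f \<longleftrightarrow> (\<forall>u v. {u, v} \<in> edges G \<longrightarrow> f u \<noteq> f v)"

text \<open>The list holds vertices, so a walk has \<open>length w - 1\<close> edges: an even list
  length means an odd number of edges. One-element lists serve as trivial walks.\<close>

definition walk :: "('a, 'b) ugraph_scheme \<Rightarrow> 'a list \<Rightarrow> bool" where
  "walk G w \<longleftrightarrow> w \<noteq> [] \<and> successively (\<lambda>u v. {u, v} \<in> edges G) w"

lemma simple_graph_edgeD:
  assumes "simple_graph G" "{u, v} \<in> edges G"
  shows "u \<noteq> v" "u \<in> verts G" "v \<in> verts G"
proof -
  obtain x y where "x \<in> verts G" "y \<in> verts G" "x \<noteq> y" "{u, v} = {x, y}"
    using assms unfolding simple_graph_def by blast
  then show "u \<noteq> v" "u \<in> verts G" "v \<in> verts G"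
    by (auto simp: doubleton_eq_iff)
qed

text \<open>A triangle is a cycle of length 3 and would bound the girth by 3.\<close>

lemma girth_ge_4_triangle_free:
  assumes "simple_graph G" "girth G \<ge> 4"
    and "{u, v} \<in> edges G" "{v, w} \<in> edges G"
  shows "{u, w} \<notin> edges G"
proof
  assume uw: "{u, w} \<in> edges G"
  have "cycle G [u, v, w]"
    using assms(3,4) uw simple_graph_edgeD[OF assms(1)]
    by (auto simp: cycle_def less_Suc_eq insert_commute)
  then have "girth G \<le> enat (length [u, v, w])"
    unfolding girth_def by (intro INF_lower) simp
  then have "girth G \<le> enat 3"
    by (simp add: numeral_3_eq_3)
  also have "enat 3 < 4"
    by (simp add: numeral_eq_enat)
  finally show False
    using assms(2) by simp
qed

text \<open>Colours alternate along the cycle, so the colour at a position depends only on its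
  parity. In an odd cycle the closing edge would join positions \<open>length c - 1\<close> and 0,
  both even.\<close>

lemma cycle_even_if_proper_2_colouring:
  assumes f: "proper_2_colouring G f" and c: "cycle G c"
  shows "even (length c)"
proof (rule ccontr)
  assume odd: "odd (length c)"
  have edge: "{c ! i, c ! (Suc i mod length c)} \<in> edges G" if "i < length c" for i
    using c that by (simp add: cycle_def)
  have alt: "f (c ! i) \<longleftrightarrow> (f (c ! 0) \<longleftrightarrow> even i)" if "i < length c" for i
    using that
  proof (induction i)
    case (Suc i)
    then have "f (c ! i) \<noteq> f (c ! Suc i)"
      using edge[of i] f by (simp add: proper_2_colouring_def)
    then show ?case
      using Suc by auto
  qed simp
  have pos: "length c > 0"
    using odd by (cases c) auto
  then have "f (c ! (length c - 1)) \<noteq> f (c ! 0)"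
    using edge[of "length c - 1"] f by (simp add: proper_2_colouring_def)
  then show False
    using alt[of "length c - 1"] pos odd by auto
qed

text \<open>Strong induction on the length: without an inner repetition the closed walk is a cycle;
  otherwise it splits at a repeated vertex into two shorter closed walks, one of which again has an
  odd number of edges.\<close>

lemma odd_closed_walk_imp_odd_cycle:
  assumes G: "simple_graph G"
    and "walk G w" "hd w = last w" "even (length w)"
  shows "\<exists>c. cycle G c \<and> odd (length c)"
  using assms(2-)
proof (induction w rule: length_induct)
  case (1 w)
  let ?E = "\<lambda>u v. {u, v} \<in> edges G"
  define c where "c = butlast w"
  define l where "l = last w"
  have w: "w = c @ [l]"
    using 1 by (simp add: c_def l_def walk_def)
  have c_ne: "c \<noteq> []" and odd_c: "odd (length c)"
    using 1 w by auto
  have l: "l = c ! 0"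
    using 1 w c_ne by (simp add: hd_append hd_conv_nth)
  have succ: "successively ?E (c @ [l])"
    using 1 w by (simp add: walk_def)
  show ?case
  proof (cases "distinct c")
    case True
    have edge: "{c ! i, c ! (Suc i mod length c)} \<in> edges G" if i: "i < length c" for i
    proof -
      have "{(c @ [l]) ! i, (c @ [l]) ! Suc i} \<in> edges G"
        using succ i by (simp add: successively_conv_nth)
      then show ?thesis
        using i l by (cases "Suc i = length c") (auto simp: nth_append)
    qed
    \<comment> \<open>Length 1 would make the closing edge a loop; parity rules out length
      2.\<close>
    have "length c \<noteq> 1"
      using edge[of 0] c_ne simple_graph_edgeD(1)[OF G, of "c ! 0" "c ! 0"] by auto
    with odd_c have "3 \<le> length c"
      by presburger
    moreover have "set c \<subseteq> verts G"
      using edge simple_graph_edgeD(2)[OF G] by (metis in_set_conv_nth subsetI)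
    ultimately have "cycle G c"
      using True edge by (simp add: cycle_def)
    then show ?thesis
      using odd_c by blast
  next
    case False
    then obtain xs a ys zs where c_split: "c = xs @ [a] @ ys @ [a] @ zs"
      using not_distinct_decomp by blast
    \<comment> \<open>\<open>?w1\<close> is the detour from \<open>a\<close> back to
      \<open>a\<close>; \<open>?w2\<close> is the walk with that detour cut out. Their lengths add
      up to \<open>length w + 1\<close>, which is odd, so one of them is even.\<close>
    let ?w1 = "a # ys @ [a]" and ?w2 = "xs @ a # zs @ [l]"
    have "walk G ?w1" "walk G ?w2"
      using succ unfolding c_split
      by (auto simp: walk_def successively_append_iff successively_Cons hd_append)
    moreover have "hd ?w2 = last ?w2"
      using l unfolding c_split by (cases xs) auto
    moreover have "length ?w1 < length w" "length ?w2 < length w"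
      unfolding w c_split by auto
    moreover have "even (length ?w1) \<or> even (length ?w2)"
      using odd_c unfolding c_split by auto
    ultimately show ?thesis
      using 1(1) by (metis last.simps last_snoc list.sel(1) append_is_Nil_conv not_Cons_self2)
  qed
qed

lemma walk_snoc:
  assumes "walk G w" "{last w, v} \<in> edges G"
  shows "walk G (w @ [v])"
  using assms by (simp add: walk_def successively_append_iff)

lemma walk_append_rev:
  assumes "walk G p" "walk G q" "{last p, last q} \<in> edges G"
  shows "walk G (p @ rev q)"
  using assms by (simp add: walk_def successively_append_iff hd_rev insert_commute)

lemma rtranclp_imp_walk:
  assumes "(\<lambda>u v. {u, v} \<in> edges G)\<^sup>*\<^sup>* r v"
  shows "\<exists>w. walk G w \<and> hd w = r \<and> last w = v"
  using assms
proof (induction rule: rtranclp_induct)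
  case base
  then show ?case
    by (intro exI[of _ "[r]"]) (simp add: walk_def)
next
  case (step u v)
  then obtain w where w: "walk G w" "hd w = r" "last w = u"
    by blast
  then have "hd (w @ [v]) = r"
    by (simp add: walk_def)
  with w step(2) show ?case
    by (intro exI[of _ "w @ [v]"]) (auto intro: walk_snoc)
qed

text \<open>Each component gets a root, and a vertex is coloured by the parity of the walks reaching
  it from there. Absence of odd closed walks makes this parity consistent.\<close>

lemma no_odd_cycle_imp_proper_2_colouring:
  assumes G: "simple_graph G" and no: "\<not> (\<exists>c. cycle G c \<and> odd (length c))"
  obtains f where "proper_2_colouring G f"
proof -
  let ?E = "\<lambda>u v. {u, v} \<in> edges G"
  define root where "root v = (SOME r. ?E\<^sup>*\<^sup>* r v)" for v
  define f where "f v \<longleftrightarrow> (\<exists>w. walk G w \<and> hd w = root v \<and> last w = v \<and> odd (length w))" for v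
  have root: "?E\<^sup>*\<^sup>* (root v) v" for v
    unfolding root_def by (rule someI) (rule rtranclp.rtrancl_refl)
  have root_eq: "root u = root v" if "{u, v} \<in> edges G" for u v
  proof -
    \<comment> \<open>Adjacent vertices are reachable from the same vertices, so \<open>SOME\<close>
      is applied to the same predicate and picks the same root.\<close>
    have "?E\<^sup>*\<^sup>* r u \<longleftrightarrow> ?E\<^sup>*\<^sup>* r v" for r
      using that by (auto simp: insert_commute intro: rtranclp.rtrancl_into_rtrancl)
    then show ?thesis
      by (simp add: root_def)
  qed
  have not_both: "\<not> (f u \<and> f v)" if e: "{u, v} \<in> edges G" for u v
  proof
    assume "f u \<and> f v"
    then obtain p q where p: "walk G p" "hd p = root u" "last p = u" "odd (length p)"
      and q: "walk G q" "hd q = root u" "last q = v" "odd (length q)"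
      unfolding f_def root_eq[OF e] by blast
    \<comment> \<open>Going out along \<open>p\<close>, across the edge and back along
      \<open>q\<close> gives a closed walk at the root with an even number of vertices.\<close>
    have "walk G (p @ rev q)"
      using p q e by (intro walk_append_rev) auto
    moreover have "hd (p @ rev q) = last (p @ rev q)"
      using p q by (simp add: walk_def last_rev)
    ultimately show False
      using odd_closed_walk_imp_odd_cycle[OF G] no p q by fastforce
  qed
  have one: "f u \<or> f v" if e: "{u, v} \<in> edges G" for u v
  proof (rule ccontr)
    assume neither: "\<not> (f u \<or> f v)"
    obtain w where w: "walk G w" "hd w = root u" "last w = u"
      using rtranclp_imp_walk[OF root] by blast
    with neither have "even (length w)"
      unfolding f_def by blast
    \<comment> \<open>Appending \<open>v\<close> to the even list \<open>w\<close> yields a walk of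
      odd list length from the common root, a witness for \<open>f v\<close>.\<close>
    moreover have "hd (w @ [v]) = root v"
      using w root_eq[OF e] by (simp add: walk_def)
    ultimately have "f v"
      unfolding f_def using w e by (intro exI[of _ "w @ [v]"]) (auto intro: walk_snoc)
    with neither show False
      by blast
  qed
  have "proper_2_colouring G f"
    unfolding proper_2_colouring_def using not_both one by blast
  then show thesis
    by (rule that)
qed

text \<open>Each edge is either kept or replaced by one of its orientations, so adjacency survives.
  This carries triangle-freeness over to \<open>H\<close>.\<close>

lemma partial_orientation_adjacent_iff:
  assumes "partial_orientation G H"
  shows "adjacent H u v \<longleftrightarrow> {u, v} \<in> edges G"
proof -
  obtain S where S: "S \<subseteq> edges G" "edges H = edges G - S"
    and "bij_betw (\<lambda>(u, v). {u, v}) (arcs H) S"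
    using assms unfolding partial_orientation_def by blast
  then have img: "(\<lambda>(u, v). {u, v}) ` arcs H = S"
    by (simp add: bij_betw_def)
  have "{u, v} \<in> S \<longleftrightarrow> (u, v) \<in> arcs H \<or> (v, u) \<in> arcs H"
    unfolding img[symmetric] by (auto simp: image_iff doubleton_eq_iff Bex_def)
  with S show ?thesis
    unfolding adjacent_def by blast
qed

lemma quasi_transitive_orientation_imp_proper_2_colouring:
  assumes G: "simple_graph G" "girth G \<ge> 4"
    and H: "partial_orientation G H" "quasi_transitive H"
  shows "proper_2_colouring G (\<lambda>v. \<exists>w. (v, w) \<in> arcs H)"
proof -
  note adj = partial_orientation_adjacent_iff[OF H(1)]
  have no_dipath: "\<not> two_dipath H u v w" for u v w
  proof
    assume d: "two_dipath H u v w"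
    then have "adjacent H u v" "adjacent H v w"
      by (auto simp: two_dipath_def adjacent_def)
    then have "\<not> adjacent H u w"
      using girth_ge_4_triangle_free[OF G] by (simp add: adj)
    with d H(2) show False
      by (auto simp: quasi_transitive_def induced_two_dipath_def)
  qed
  have asym: "u \<noteq> v \<and> (v, u) \<notin> arcs H" if "(u, v) \<in> arcs H" for u v
    using that H(1) by (auto simp: partial_orientation_def mixed_graph_def)
  \<comment> \<open>A 2-dipath needs three distinct vertices; the case \<open>w = u\<close> is
    excluded by asymmetry of the arcs instead.\<close>
  have sink: "(v, w) \<notin> arcs H" if "(u, v) \<in> arcs H" for u v w
    using no_dipath[of u v w] that asym unfolding two_dipath_def by auto
  have "(u, v) \<in> arcs H \<or> (v, u) \<in> arcs H" if "{u, v} \<in> edges G" for u v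
  proof -
    \<comment> \<open>An edge left unoriented would require a 2-dipath between its ends.\<close>
    have "{u, v} \<notin> edges H"
      using H(2) no_dipath unfolding quasi_transitive_def by blast
    with that show ?thesis
      unfolding adj[symmetric] by (simp add: adjacent_def)
  qed
  then show ?thesis
    unfolding proper_2_colouring_def using sink by blast
qed

text \<open>With every edge directed from colour \<open>True\<close> to colour \<open>False\<close>,
  the head of an arc has no outgoing arc, so there is no 2-dipath; no edge remains for condition (2)
  to constrain.\<close>

lemma proper_2_colouring_imp_quasi_transitive_orientation:
  fixes G :: "'a ugraph"
  assumes G: "simple_graph G" and f: "proper_2_colouring G f"
  shows "\<exists>H. partial_orientation G H \<and> quasi_transitive H"
proof -
  define A where "A = {(u, v). {u, v} \<in> edges G \<and> f u \<and> \<not> f v}"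
  define H where "H = \<lparr>verts = verts G, edges = {}, arcs = A\<rparr>"
  have mixed: "mixed_graph H"
    using simple_graph_edgeD[OF G]
    by (auto simp: mixed_graph_def simple_graph_def H_def A_def)
  \<comment> \<open>The colours of the two ends determine the direction, so only one orientation of
    an edge lies in \<open>A\<close>.\<close>
  have "inj_on (\<lambda>(u, v). {u, v}) A"
    by (auto simp: inj_on_def A_def doubleton_eq_iff)
  moreover have "(\<lambda>(u, v). {u, v}) ` A = edges G"
  proof (intro equalityI subsetI)
    fix e assume e: "e \<in> edges G"
    then obtain u v where uv: "e = {u, v}"
      using G unfolding simple_graph_def by blast
    with e f have "f u \<noteq> f v"
      unfolding proper_2_colouring_def by blast
    with e uv have "(u, v) \<in> A \<or> (v, u) \<in> A"
      by (auto simp: A_def insert_commute)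
    with uv show "e \<in> (\<lambda>(u, v). {u, v}) ` A"
      by (auto simp: image_iff Bex_def insert_commute)
  qed (auto simp: A_def)
  ultimately have "partial_orientation G H"
    using mixed by (auto simp: partial_orientation_def bij_betw_def H_def)
  moreover have "quasi_transitive H"
    using mixed
    by (auto simp: quasi_transitive_def induced_two_dipath_def two_dipath_def H_def A_def)
  ultimately show ?thesis
    by blast
qed

theorem theorem2p3:
  fixes \<Gamma> :: "'a ugraph"
  assumes "simple_graph \<Gamma>"
    and "girth \<Gamma> \<ge> 4"
  shows "(\<exists>H. partial_orientation \<Gamma> H \<and> quasi_transitive H) \<longleftrightarrow>
         \<not> (\<exists>c. cycle \<Gamma> c \<and> odd (length c))"
proof
  assume "\<exists>H. partial_orientation \<Gamma> H \<and> quasi_transitive H"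
  then show "\<not> (\<exists>c. cycle \<Gamma> c \<and> odd (length c))"
    using quasi_transitive_orientation_imp_proper_2_colouring[OF assms]
      cycle_even_if_proper_2_colouring by blast
next
  assume "\<not> (\<exists>c. cycle \<Gamma> c \<and> odd (length c))"
  then obtain f where "proper_2_colouring \<Gamma> f"
    using no_odd_cycle_imp_proper_2_colouring[OF assms(1)] by blast
  then show "\<exists>H. partial_orientation \<Gamma> H \<and> quasi_transitive H"
    using proper_2_colouring_imp_quasi_transitive_orientation[OF assms(1)] by blast
qed

end
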